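(* Let $\mathbb{K}$ be a field and let $I=B(u)\subseteq\mathbb{K}[x,y,z]$ be a principal Borel ideal, where $u$ is a monomial (and the variables are ordered as $x_1=x$, $x_2=y$, $x_3=z$). Then $I$ satisfies the non-pure dual exchange property.
   Context: Write $x_1=x$, $x_2=y$, $x_3=z$. For a monomial $u=x_1^{a_1}x_2^{a_2}x_3^{a_3}$, $\deg(u)=a_1+a_2+a_3$ and $\deg_{x_i}(u)=a_i$. For a monomial ideal $I$, $G(I)$ is its minimal set of monomial generators. The ideal $I$ satisfies the non-pure dual exchange property if for all $u,v\in G(I)$ with $\deg(u)\le\deg(v)$ and for all $i$ with $\deg_{x_i}(v)<\deg_{x_i}(u)$, there exists $j$ with $\deg_{x_j}(v)>\deg_{x_j}(u)$ such that $x_i(v/x_j)\in I$. A monomial ideal $I$ is a Borel ideal (strongly stable) if it is closed under Borel moves: whenever $u\in I$ is a monomial and $x_j\mid u$, then $\frac{x_i}{x_j}u\in I$ for all $i<j$. The Borel generators of a Borel ideal $I$ form the unique minimal set of monomials whose Borel moves generate $I$, i.e. the unique inclusion-minimal set of monomials such that $I$ is the smallest Borel ideal containing it. A principal Borel ideal is a Borel ideal with a single Borel generator $u$, written $B(u)$; equivalently $B(u)$ is the smallest Borel ideal containing $u$. *)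

theory Defs
  imports Complex_Main "HOL-Library.Poly_Mapping"
begin

datatype var = X | Y | Z

text \<open>The variable \<open>x\<^sub>i\<close> is the one of index \<open>i\<close>.\<close>
fun index :: "var \<Rightarrow> nat" where
  "index X = 1" | "index Y = 2" | "index Z = 3"

abbreviation "lookup \<equiv> Poly_Mapping.lookup"
abbreviation "keys \<equiv> Poly_Mapping.keys"

text \<open>A monomial is written additively, as its exponent vector; the degree of \<open>u\<close> in the
  variable \<open>i\<close> is \<^term>\<open>lookup u i\<close>. The polynomial ring is the monoid ring of the monomials,
  with the convolution product of \<^theory>\<open>HOL-Library.Poly_Mapping\<close>.\<close>
type_synonym monomial = "var \<Rightarrow>\<^sub>0 nat"
type_synonym 'k poly3 = "monomial \<Rightarrow>\<^sub>0 'k"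

definition mdeg :: "monomial \<Rightarrow> nat" where
  "mdeg u = lookup u X + lookup u Y + lookup u Z"

definition mono_poly :: "monomial \<Rightarrow> 'k::field poly3" where
  "mono_poly u = Poly_Mapping.single u 1"

text \<open>The monomial \<open>x\<^sub>i (u / x\<^sub>j)\<close>. Subtraction of exponents truncates, so this is
  meaningful only when \<open>x\<^sub>j\<close> divides \<open>u\<close>.\<close>
definition exchange :: "var \<Rightarrow> var \<Rightarrow> monomial \<Rightarrow> monomial" where
  "exchange i j u = Poly_Mapping.single i 1 + (u - Poly_Mapping.single j 1)"

text \<open>Ideals of a commutative ring are the submodules of the ring over itself:
  \<open>ideal.subspace I\<close> says that \<open>I\<close> is an ideal, and \<open>ideal.span S\<close> is the ideal generated
  by \<open>S\<close>.\<close>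
interpretation ideal: module "(*) :: 'a::comm_ring_1 \<Rightarrow> 'a \<Rightarrow> 'a"
  by unfold_locales (simp_all add: algebra_simps)

text \<open>As a rewrite rule this would undo the associativity of multiplication.\<close>
declare ideal.scale_scale [simp del]

definition monomial_ideal :: "'k::field poly3 set \<Rightarrow> bool" where
  "monomial_ideal I \<longleftrightarrow> (\<exists>S. I = ideal.span (mono_poly ` S))"

definition minimal_generators :: "'k::field poly3 set \<Rightarrow> monomial set \<Rightarrow> bool" where
  "minimal_generators I S \<longleftrightarrow>
     ideal.span (mono_poly ` S) = I \<and> (\<forall>T. T \<subset> S \<longrightarrow> ideal.span (mono_poly ` T) \<noteq> I)"

text \<open>For a monomial ideal the set exists and is unique, see \<open>ex1_minimal_generators\<close>.\<close>
definition gens :: "'k::field poly3 set \<Rightarrow> monomial set" where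
  "gens I = (THE S. minimal_generators I S)"

definition non_pure_dual_exchange :: "'k::field poly3 set \<Rightarrow> bool" where
  "non_pure_dual_exchange I \<longleftrightarrow>
     (\<forall>u\<in>gens I. \<forall>v\<in>gens I. mdeg u \<le> mdeg v \<longrightarrow>
        (\<forall>i. lookup v i < lookup u i \<longrightarrow>
           (\<exists>j. lookup v j > lookup u j \<and> mono_poly (exchange i j v) \<in> I)))"

definition borel_ideal :: "'k::field poly3 set \<Rightarrow> bool" where
  "borel_ideal I \<longleftrightarrow> monomial_ideal I \<and>
     (\<forall>u i j. mono_poly u \<in> I \<and> lookup u j > 0 \<and> index i < index j \<longrightarrow>
        mono_poly (exchange i j u) \<in> I)"

text \<open>The smallest Borel ideal containing \<open>u\<close>; it is one by \<open>borel_ideal_principal_borel\<close>.\<close>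
definition principal_borel :: "monomial \<Rightarrow> 'k::field poly3 set" where
  "principal_borel u = borel_ideal hull {mono_poly u}"

lemma poly_eq_sum_terms:
  fixes p :: "'a \<Rightarrow>\<^sub>0 'b::comm_monoid_add"
  shows "p = (\<Sum>m\<in>keys p. Poly_Mapping.single m (lookup p m))"
proof (rule poly_mapping_eqI)
  fix k
  have "lookup (\<Sum>m\<in>keys p. Poly_Mapping.single m (lookup p m)) k
      = (\<Sum>m\<in>keys p. if m = k then lookup p m else 0)"
    by (simp add: lookup_sum lookup_single when_def)
  also have "\<dots> = lookup p k"
    by (simp add: in_keys_iff)
  finally show "lookup p k = lookup (\<Sum>m\<in>keys p. Poly_Mapping.single m (lookup p m)) k" ..
qed

lemma keys_times_obtain:
  fixes p q :: "'k::field poly3"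
  assumes "m \<in> keys (p * q)"
  obtains a b where "a \<in> keys p" "b \<in> keys q" "m = a + b"
  using assms keys_mult[of p q] by blast

lemma in_span_monomials_iff:
  fixes p :: "'k::field poly3"
  shows "p \<in> ideal.span (mono_poly ` S) \<longleftrightarrow> (\<forall>m\<in>keys p. \<exists>s\<in>S. \<exists>t. m = t + s)"
proof
  let ?J = "{p :: 'k poly3. \<forall>m\<in>keys p. \<exists>s\<in>S. \<exists>t. m = t + s}"
  have "ideal.subspace ?J"
  proof (rule ideal.subspaceI)
    fix c p :: "'k poly3" assume p: "p \<in> ?J"
    have "\<exists>s\<in>S. \<exists>t. m = t + s" if m: "m \<in> keys (c * p)" for m
    proof -
      obtain a b where "b \<in> keys p" "m = a + b" using keys_times_obtain[OF m] by blast
      moreover obtain s t where "s \<in> S" "b = t + s" using p \<open>b \<in> keys p\<close> by blast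
      ultimately have "m = (a + t) + s" by (simp add: add.assoc)
      then show ?thesis using \<open>s \<in> S\<close> by blast
    qed
    then show "c * p \<in> ?J" by blast
  next
    fix p q :: "'k poly3" assume "p \<in> ?J" "q \<in> ?J"
    then show "p + q \<in> ?J" using keys_add[of p q] by blast
  qed simp
  moreover have "mono_poly ` S \<subseteq> ?J"
  proof
    fix p :: "'k poly3" assume "p \<in> mono_poly ` S"
    then obtain s where s: "s \<in> S" "p = mono_poly s" by blast
    then have "\<exists>s'\<in>S. \<exists>t. s = t + s'" by (intro bexI[of _ s] exI[of _ 0]) auto
    then show "p \<in> ?J" using s by (simp add: mono_poly_def)
  qed
  ultimately have "ideal.span (mono_poly ` S) \<subseteq> ?J"
    by (rule ideal.span_minimal[rotated])
  then show "\<forall>m\<in>keys p. \<exists>s\<in>S. \<exists>t. m = t + s" if "p \<in> ideal.span (mono_poly ` S)"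
    using that by blast
next
  assume *: "\<forall>m\<in>keys p. \<exists>s\<in>S. \<exists>t. m = t + s"
  have "Poly_Mapping.single m (lookup p m) \<in> ideal.span (mono_poly ` S)" if m: "m \<in> keys p" for m
  proof -
    obtain s t where "s \<in> S" "m = t + s" using * m by blast
    then have "Poly_Mapping.single m (lookup p m)
        = Poly_Mapping.single t (lookup p m) * mono_poly s"
      by (simp add: mono_poly_def mult_single)
    then show ?thesis using \<open>s \<in> S\<close> by (simp add: ideal.span_base ideal.span_scale)
  qed
  then have "(\<Sum>m\<in>keys p. Poly_Mapping.single m (lookup p m)) \<in> ideal.span (mono_poly ` S)"
    by (rule ideal.span_sum)
  then show "p \<in> ideal.span (mono_poly ` S)" by (simp only: poly_eq_sum_terms[of p, symmetric])
qed

lemma mono_poly_in_span_iff: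
  "(mono_poly m :: 'k::field poly3) \<in> ideal.span (mono_poly ` S) \<longleftrightarrow> (\<exists>s\<in>S. \<exists>t. m = t + s)"
  by (simp add: in_span_monomials_iff) (simp add: mono_poly_def)

lemma monomial_ideal_iff:
  fixes I :: "'k::field poly3 set"
  shows "monomial_ideal I \<longleftrightarrow> ideal.subspace I \<and> (\<forall>p\<in>I. \<forall>m\<in>keys p. mono_poly m \<in> I)"
proof
  assume "monomial_ideal I"
  then show "ideal.subspace I \<and> (\<forall>p\<in>I. \<forall>m\<in>keys p. mono_poly m \<in> I)"
    unfolding monomial_ideal_def
    by (auto simp: mono_poly_in_span_iff) (auto simp: in_span_monomials_iff)
next
  assume I: "ideal.subspace I \<and> (\<forall>p\<in>I. \<forall>m\<in>keys p. mono_poly m \<in> I)"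
  let ?S = "{m. (mono_poly m :: 'k poly3) \<in> I}"
  have "ideal.span (mono_poly ` ?S) \<subseteq> I"
    using I by (intro ideal.span_minimal) auto
  moreover have "I \<subseteq> ideal.span (mono_poly ` ?S)"
  proof
    fix p assume "p \<in> I"
    have "\<exists>s\<in>?S. \<exists>t. m = t + s" if "m \<in> keys p" for m
      using I \<open>p \<in> I\<close> that by (intro bexI[of _ m] exI[of _ 0]) auto
    then show "p \<in> ideal.span (mono_poly ` ?S)" unfolding in_span_monomials_iff by blast
  qed
  ultimately show "monomial_ideal I" unfolding monomial_ideal_def by blast
qed

lemma borel_ideal_Inter: "(\<And>I. I \<in> F \<Longrightarrow> borel_ideal I) \<Longrightarrow> borel_ideal (\<Inter>F)"
  by (simp add: borel_ideal_def monomial_ideal_iff ideal.subspace_Inter) blast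

lemma borel_ideal_principal_borel: "borel_ideal (principal_borel u)"
  unfolding principal_borel_def by (rule hull_in) (auto intro: borel_ideal_Inter)

lemma mono_poly_in_principal_borel: "mono_poly u \<in> principal_borel u"
  unfolding principal_borel_def by (rule hull_inc) simp

lemma principal_borel_least: "borel_ideal J \<Longrightarrow> mono_poly u \<in> J \<Longrightarrow> principal_borel u \<subseteq> J"
  unfolding principal_borel_def by (rule hull_minimal) auto

lemma mdeg_add: "mdeg (a + b) = mdeg a + mdeg b"
  by (simp add: mdeg_def lookup_add)

lemma mdeg_eq_0_iff: "mdeg a = 0 \<longleftrightarrow> a = 0"
proof
  assume "mdeg a = 0"
  then have "lookup a i = 0" for i by (cases i) (auto simp: mdeg_def)
  then show "a = 0" by (intro poly_mapping_eqI) simp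
qed (simp add: mdeg_def)

lemma span_eq_if_generates:
  fixes I :: "'k::field poly3 set"
  assumes "monomial_ideal I" "\<And>s. s \<in> S \<Longrightarrow> mono_poly s \<in> I"
    "\<And>m. mono_poly m \<in> I \<Longrightarrow> \<exists>s\<in>S. \<exists>t. m = t + s"
  shows "ideal.span (mono_poly ` S) = I"
proof
  show "ideal.span (mono_poly ` S) \<subseteq> I"
  proof (rule ideal.span_minimal)
    show "mono_poly ` S \<subseteq> I" using assms(2) by blast
    show "ideal.subspace I" using assms(1) unfolding monomial_ideal_iff by blast
  qed
  show "I \<subseteq> ideal.span (mono_poly ` S)"
  proof
    fix p assume "p \<in> I"
    then have "mono_poly m \<in> I" if "m \<in> keys p" for m
      using assms(1) that unfolding monomial_ideal_iff by blast
    then show "p \<in> ideal.span (mono_poly ` S)"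
      unfolding in_span_monomials_iff using assms(3) by blast
  qed
qed

lemma minimal_generators_iff:
  fixes I :: "'k::field poly3 set"
  assumes I: "monomial_ideal I"
  shows "minimal_generators I S \<longleftrightarrow>
    S = {m. mono_poly m \<in> I \<and> (\<forall>s t. m = t + s \<and> mono_poly s \<in> I \<longrightarrow> s = m)}" (is "_ \<longleftrightarrow> S = ?M")
proof -
  have ex: "\<exists>s\<in>?M. \<exists>t. m = t + s" if "mono_poly m \<in> I" for m
    using that
  proof (induction "mdeg m" arbitrary: m rule: less_induct)
    case less
    show ?case
    proof (cases "m \<in> ?M")
      case True
      then show ?thesis by (intro bexI[of _ m] exI[of _ 0]) auto
    next
      case False
      then obtain s t where st: "m = t + s" "mono_poly s \<in> I" "s \<noteq> m" using less.prems by blast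
      then have "t \<noteq> 0" by auto
      then have "mdeg s < mdeg m" using st(1) mdeg_eq_0_iff[of t] by (simp add: mdeg_add)
      from less.hyps[OF this st(2)] obtain s' t' where s': "s' \<in> ?M" "s = t' + s'" by blast
      then have "m = (t + t') + s'" using st(1) by (simp add: add.assoc)
      then show ?thesis using s'(1) by blast
    qed
  qed
  have gen: "ideal.span (mono_poly ` ?M) = I"
    by (rule span_eq_if_generates[OF I _ ex]) auto
  have sub: "?M \<subseteq> T" if T: "ideal.span (mono_poly ` T) = I" for T
  proof
    fix m assume m: "m \<in> ?M"
    then have "(mono_poly m :: 'k poly3) \<in> ideal.span (mono_poly ` T)" using T by blast
    then obtain s t where st: "s \<in> T" "m = t + s" by (auto simp: mono_poly_in_span_iff)
    have "mono_poly s \<in> I" using st(1) T ideal.span_base by blast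
    then have "s = m" using m st(2) by simp
    then show "m \<in> T" using st(1) by simp
  qed
  show ?thesis
  proof
    assume S: "minimal_generators I S"
    then have "?M \<subseteq> S" by (intro sub) (simp add: minimal_generators_def)
    moreover have "\<not> ?M \<subset> S" using S gen unfolding minimal_generators_def by blast
    ultimately show "S = ?M" by blast
  next
    assume S: "S = ?M"
    have "ideal.span (mono_poly ` T) \<noteq> I" if "T \<subset> ?M" for T
      using sub[of T] that by blast
    then show "minimal_generators I S" unfolding S minimal_generators_def using gen by blast
  qed
qed

lemma ex1_minimal_generators: "monomial_ideal I \<Longrightarrow> \<exists>!S. minimal_generators I S"
  by (simp add: minimal_generators_iff)

lemma minimal_generators_gens: "monomial_ideal I \<Longrightarrow> minimal_generators I (gens I)"
  unfolding gens_def by (rule theI') (rule ex1_minimal_generators)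

end

theory Submission
  imports Defs
begin

text \<open>A monomial \<open>m\<close> lies in \<open>B(u)\<close> iff each of the partial degrees \<open>deg\<^sub>x\<close>,
  \<open>deg\<^sub>x + deg\<^sub>y\<close> and \<open>deg\<^sub>x + deg\<^sub>y + deg\<^sub>z\<close> is at least as large for \<open>m\<close> as for \<open>u\<close>.
  Given \<open>p, q \<in> B(u)\<close> with \<open>deg p \<le> deg q\<close> and \<open>deg\<^sub>i q < deg\<^sub>i p\<close>, some \<open>j\<close> has
  \<open>deg\<^sub>j q > deg\<^sub>j p\<close>, and any such \<open>j\<close> works: a partial degree that drops by one in the
  exchange still dominates that of \<open>p\<close>, hence that of \<open>u\<close>.\<close>

definition borel_le :: "monomial \<Rightarrow> monomial \<Rightarrow> bool" where
  "borel_le u m \<longleftrightarrow> lookup u X \<le> lookup m X \<and>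
     lookup u X + lookup u Y \<le> lookup m X + lookup m Y \<and> mdeg u \<le> mdeg m"

lemma borel_le_refl: "borel_le u u"
  by (simp add: borel_le_def)

lemma borel_le_add: "borel_le u m \<Longrightarrow> borel_le u (t + m)"
  by (simp add: borel_le_def mdeg_def lookup_add)

lemma lookup_exchange:
  "lookup (exchange i j u) k = (if k = i then 1 else 0) + (lookup u k - (if k = j then 1 else 0))"
  by (simp add: exchange_def lookup_add lookup_minus lookup_single when_def)

text \<open>A Borel move shifts exponent to an earlier variable, so no partial degree drops.\<close>

lemma borel_le_borel_move:
  assumes "borel_le u m" "lookup m j > 0" "index i < index j"
  shows "borel_le u (exchange i j m)"
  using assms by (cases i; cases j) (auto simp: borel_le_def mdeg_def lookup_exchange)

text \<open>By \<open>borel_le_add\<close> these monomials are closed under multiples, so their span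
  contains no further monomial.\<close>

lemma mono_poly_in_span_borel_le_iff:
  "(mono_poly m :: 'k::field poly3) \<in> ideal.span (mono_poly ` {m. borel_le u m}) \<longleftrightarrow> borel_le u m"
proof -
  have "\<exists>s\<in>{m. borel_le u m}. \<exists>t. m = t + s" if "borel_le u m"
    using that by (intro bexI[of _ m] exI[of _ 0]) auto
  then show ?thesis
    unfolding mono_poly_in_span_iff using borel_le_add by blast
qed

lemma borel_ideal_span_borel_le:
  "borel_ideal (ideal.span (mono_poly ` {m. borel_le u m}) :: 'k::field poly3 set)"
  unfolding borel_ideal_def mono_poly_in_span_borel_le_iff
proof (intro conjI allI impI)
  show "monomial_ideal (ideal.span (mono_poly ` {m. borel_le u m}) :: 'k poly3 set)"
    unfolding monomial_ideal_def by (rule exI) (rule refl)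
qed (elim conjE, rule borel_le_borel_move)

text \<open>Moves from z to y and from y to x lead from \<open>u\<close> to a divisor of
  \<open>m\<close>; each lowers \<open>2 * lookup u Z + lookup u Y\<close> by one.\<close>

lemma borel_ideal_upward_closed:
  fixes J :: "'k::field poly3 set"
  assumes J: "borel_ideal J" and "mono_poly u \<in> J" "borel_le u m"
  shows "mono_poly m \<in> J"
  using assms(2,3)
proof (induction "2 * lookup u Z + lookup u Y" arbitrary: u rule: less_induct)
  case less
  have step: ?thesis if "lookup u j > 0" "index i < index j"
    "2 * lookup (exchange i j u) Z + lookup (exchange i j u) Y < 2 * lookup u Z + lookup u Y"
    "borel_le (exchange i j u) m" for i j
    using less.hyps[of "exchange i j u"] that J less.prems(1) unfolding borel_ideal_def by blast
  consider "lookup m Z < lookup u Z" | "lookup m Y < lookup u Y" "lookup u Z \<le> lookup m Z"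
    | "lookup u Y \<le> lookup m Y" "lookup u Z \<le> lookup m Z"
    by linarith
  then show ?case
  proof cases
    \<comment> \<open>As \<open>mdeg u \<le> mdeg m\<close>, the deficit of \<open>m\<close> in z
      leaves strict slack in the degree in x and y, which admits a move from z to y. Case 2 is
      alike, one variable earlier.\<close>
    case 1
    then show ?thesis using less.prems(2)
      by (intro step[of Z Y]) (auto simp: borel_le_def mdeg_def lookup_exchange)
  next
    case 2
    then show ?thesis using less.prems(2)
      by (intro step[of Y X]) (auto simp: borel_le_def mdeg_def lookup_exchange)
  next
    \<comment> \<open>Now \<open>u\<close> divides \<open>m\<close>, so the truncated difference
      \<open>m - u\<close> is exact.\<close>
    case 3
    have "lookup m k = lookup ((m - u) + u) k" for k
      using 3 less.prems(2) by (cases k) (auto simp: borel_le_def lookup_add lookup_minus)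
    then have "m = (m - u) + u" by (rule poly_mapping_eqI)
    then have "(mono_poly m :: 'k poly3) = mono_poly (m - u) * mono_poly u"
      by (simp add: mono_poly_def mult_single)
    moreover have "ideal.subspace J"
      using J unfolding borel_ideal_def monomial_ideal_iff by blast
    ultimately show ?thesis
      using less.prems(1) by (simp only: ideal.subspace_scale)
  qed
qed

lemma mono_poly_in_principal_borel_iff:
  "(mono_poly m :: 'k::field poly3) \<in> principal_borel u \<longleftrightarrow> borel_le u m"
proof
  assume m: "(mono_poly m :: 'k poly3) \<in> principal_borel u"
  have "(principal_borel u :: 'k poly3 set) \<subseteq> ideal.span (mono_poly ` {m. borel_le u m})"
    by (intro principal_borel_least borel_ideal_span_borel_le ideal.span_base)
      (simp add: borel_le_refl)
  then show "borel_le u m"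
    using m mono_poly_in_span_borel_le_iff by blast
qed (intro borel_ideal_upward_closed[OF borel_ideal_principal_borel mono_poly_in_principal_borel])

text \<open>The degree in x drops only if \<open>j = X\<close>, and then
  \<open>lookup p X < lookup q X\<close>. The degree in x and y drops only if \<open>i = Z\<close>;
  then \<open>lookup q Z < lookup p Z\<close> and \<open>mdeg p \<le> mdeg q\<close> make it
  strictly larger for \<open>q\<close> than for \<open>p\<close>.\<close>

lemma borel_le_exchange:
  assumes "borel_le u p" "borel_le u q" "mdeg p \<le> mdeg q"
    "lookup q i < lookup p i" "lookup p j < lookup q j"
  shows "borel_le u (exchange i j q)"
  using assms by (cases i; cases j) (auto simp: borel_le_def mdeg_def lookup_exchange)

lemma ex_lookup_less:
  assumes "mdeg p \<le> mdeg q" "lookup q i < lookup p i"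
  shows "\<exists>j. lookup p j < lookup q j"
proof (rule ccontr)
  assume "\<not> ?thesis"
  then have "lookup q j \<le> lookup p j" for j by (simp add: not_less)
  from this[of X] this[of Y] this[of Z] assms show False
    by (cases i) (auto simp: mdeg_def)
qed

lemma mono_poly_gens_in:
  fixes I :: "'k::field poly3 set"
  assumes "monomial_ideal I" "m \<in> gens I"
  shows "mono_poly m \<in> I"
proof -
  have "ideal.span (mono_poly ` gens I) = I"
    using minimal_generators_gens[OF assms(1)] unfolding minimal_generators_def by (rule conjunct1)
  moreover have "(mono_poly m :: 'k poly3) \<in> ideal.span (mono_poly ` gens I)"
    using assms(2) by (intro ideal.span_base imageI)
  ultimately show ?thesis by simp
qed

theorem corollary3p9:
  fixes I :: "'k::field poly3 set" and u :: monomial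
  assumes "I = principal_borel u"
  shows "non_pure_dual_exchange I"
proof -
  have in_I: "mono_poly m \<in> I \<longleftrightarrow> borel_le u m" for m
    by (simp add: assms mono_poly_in_principal_borel_iff)
  have "monomial_ideal I"
    using borel_ideal_principal_borel[of u] unfolding assms borel_ideal_def by blast
  then have "borel_le u m" if "m \<in> gens I" for m
    using mono_poly_gens_in that in_I by blast
  then show ?thesis
    unfolding non_pure_dual_exchange_def in_I
    by (meson borel_le_exchange ex_lookup_less)
qed

end
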